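(* Let $K=K_1\times\cdots\times K_r$, where each $K_i\subseteq\mathbb{R}^{n_i}$ ($i\in I=\{1,\dots,r\}$) is a regular closed convex cone, let $n=\sum_{i=1}^r n_i$, and let $A=[A_1\ \cdots\ A_r]\in\mathbb{R}^{m\times n}$ with blocks $A_i\in\mathbb{R}^{m\times n_i}$. Define \[ B=\{i\in I \mid \exists\, x:\ Ax=0,\ x\in K,\ x_i\in\operatorname{int}K_i\},\qquad N=\{i\in I \mid \exists\, y:\ A^{\rm T}y\in K^*,\ A_i^{\rm T}y\in\operatorname{int}K_i^*\}, \] \[ B_0=\{i\in I \mid A^{\rm T}y\in K^*\Rightarrow A_i^{\rm T}y=0\},\qquad N_0=\{i\in I \mid Ax=0,\ x\in K\Rightarrow x_i=0\}, \] where in $B_0$ and $N_0$ the implications are required for all $y\in\mathbb{R}^m$ and all $x\in\mathbb{R}^n$, respectively. Then: (i) \[ B=\{i\in I\mid \operatorname{ri}(A_iK_i)\cap\operatorname{Lin}(AK)\neq\emptyset\},\qquad N=\{i\in I\mid A_i(K_i\setminus\{0\})\cap\operatorname{Lin}(\overline{AK})=\emptyset\}. \] (ii) \[ B_0=\{i\in I\mid \operatorname{ri}(A_iK_i)\cap\operatorname{Lin}(\overline{AK})\neq\emptyset\},\qquad N_0=\{i\in I\mid A_i(K_i\setminus\{0\})\cap\operatorname{Lin}(AK)=\emptyset\}. \]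
   Context: A closed convex cone is regular if it is pointed (contains no line) and has nonempty interior. For a cone $K\subseteq\mathbb{R}^n$, $K^*=\{s\in\mathbb{R}^n\mid s^{\rm T}x\ge 0\ \forall x\in K\}$ is the dual cone; for $K=K_1\times\cdots\times K_r$ one has $K^*=K_1^*\times\cdots\times K_r^*$. A vector $x\in\mathbb{R}^n$ is written in blocks $x=(x_1,\dots,x_r)$ with $x_i\in\mathbb{R}^{n_i}$. $AK=\{Ax\mid x\in K\}$ and $\overline{AK}$ is its closure; $A_iS=\{A_iu\mid u\in S\}$ for $S\subseteq\mathbb{R}^{n_i}$. For a convex cone $C\subseteq\mathbb{R}^d$, $\operatorname{Lin}(C)=\{x\mid x\in C,\ -x\in C\}$ is its lineality space, i.e. the largest linear subspace contained in $C$. $\operatorname{int}$ and $\operatorname{ri}$ denote interior and relative interior. *)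

theory Defs
  imports "HOL-Analysis.Analysis"
begin

text \<open>
  The coordinates of \<open>\<real>\<^sup>n\<close> are indexed by the finite type \<open>'n\<close>, and the blocks by the finite type
  \<open>'r\<close>. A map \<open>b :: 'n \<Rightarrow> 'r\<close> sends a coordinate to the block it belongs to, so the sizes
  \<open>n\<^sub>i = card {j. b j = i}\<close> are arbitrary and add up to \<open>n\<close>. The factor of dimension \<open>n\<^sub>i\<close> is
  represented by the coordinate subspace \<open>block_space b i\<close> (vectors padded with zeros), with its
  subspace topology: interiors and dual cones of the \<open>K i\<close> are taken inside this subspace.
\<close>

definition block_space :: "('n::finite \<Rightarrow> 'r::finite) \<Rightarrow> 'r \<Rightarrow> (real ^ 'n) set" where
  "block_space b i = {x. \<forall>j. b j \<noteq> i \<longrightarrow> x $ j = 0}"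

definition vec_block :: "('n::finite \<Rightarrow> 'r::finite) \<Rightarrow> 'r \<Rightarrow> real ^ 'n \<Rightarrow> real ^ 'n" where
  "vec_block b i x = (\<chi> j. if b j = i then x $ j else 0)"

definition mat_block ::
    "('n::finite \<Rightarrow> 'r::finite) \<Rightarrow> 'r \<Rightarrow> real ^ 'n ^ 'm::finite \<Rightarrow> real ^ 'n ^ 'm" where
  "mat_block b i A = (\<chi> k j. if b j = i then A $ k $ j else 0)"

definition block_int ::
    "('n::finite \<Rightarrow> 'r::finite) \<Rightarrow> 'r \<Rightarrow> (real ^ 'n) set \<Rightarrow> (real ^ 'n) set" where
  "block_int b i S = (top_of_set (block_space b i)) interior_of S"

definition contains_line :: "'a::real_vector set \<Rightarrow> bool" where
  "contains_line S \<longleftrightarrow> (\<exists>x d. d \<noteq> 0 \<and> (\<forall>t::real. x + t *\<^sub>R d \<in> S))"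

definition regular_block_cone ::
    "('n::finite \<Rightarrow> 'r::finite) \<Rightarrow> 'r \<Rightarrow> (real ^ 'n) set \<Rightarrow> bool" where
  "regular_block_cone b i C \<longleftrightarrow>
     C \<subseteq> block_space b i \<and> closed C \<and> convex C \<and> cone C \<and>
     \<not> contains_line C \<and> block_int b i C \<noteq> {}"

definition dual_cone :: "'a::real_inner set \<Rightarrow> 'a set" where
  "dual_cone C = {s. \<forall>x\<in>C. 0 \<le> s \<bullet> x}"

definition block_dual ::
    "('n::finite \<Rightarrow> 'r::finite) \<Rightarrow> 'r \<Rightarrow> (real ^ 'n) set \<Rightarrow> (real ^ 'n) set" where
  "block_dual b i C = {s \<in> block_space b i. \<forall>x\<in>C. 0 \<le> s \<bullet> x}"

definition prod_cone ::
    "('n::finite \<Rightarrow> 'r::finite) \<Rightarrow> ('r \<Rightarrow> (real ^ 'n) set) \<Rightarrow> (real ^ 'n) set" where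
  "prod_cone b K = {x. \<forall>i. vec_block b i x \<in> K i}"

definition Lin :: "'a::real_vector set \<Rightarrow> 'a set" where
  "Lin C = {x. x \<in> C \<and> - x \<in> C}"

definition index_B ::
    "('n::finite \<Rightarrow> 'r::finite) \<Rightarrow> ('r \<Rightarrow> (real ^ 'n) set) \<Rightarrow> real ^ 'n ^ 'm::finite \<Rightarrow> 'r set" where
  "index_B b K A =
     {i. \<exists>x. A *v x = 0 \<and> x \<in> prod_cone b K \<and> vec_block b i x \<in> block_int b i (K i)}"

definition index_N ::
    "('n::finite \<Rightarrow> 'r::finite) \<Rightarrow> ('r \<Rightarrow> (real ^ 'n) set) \<Rightarrow> real ^ 'n ^ 'm::finite \<Rightarrow> 'r set" where
  "index_N b K A =
     {i. \<exists>y. transpose A *v y \<in> dual_cone (prod_cone b K) \<and>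
             transpose (mat_block b i A) *v y \<in> block_int b i (block_dual b i (K i))}"

definition index_B0 ::
    "('n::finite \<Rightarrow> 'r::finite) \<Rightarrow> ('r \<Rightarrow> (real ^ 'n) set) \<Rightarrow> real ^ 'n ^ 'm::finite \<Rightarrow> 'r set" where
  "index_B0 b K A =
     {i. \<forall>y. transpose A *v y \<in> dual_cone (prod_cone b K) \<longrightarrow>
             transpose (mat_block b i A) *v y = 0}"

definition index_N0 ::
    "('n::finite \<Rightarrow> 'r::finite) \<Rightarrow> ('r \<Rightarrow> (real ^ 'n) set) \<Rightarrow> real ^ 'n ^ 'm::finite \<Rightarrow> 'r set" where
  "index_N0 b K A =
     {i. \<forall>x. A *v x = 0 \<and> x \<in> prod_cone b K \<longrightarrow> vec_block b i x = 0}"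

end

theory Submission
  imports Defs
begin

text \<open>
  Every equality follows from the splitting \<open>A x = \<Sum>\<^sub>i A\<^sub>i x\<^sub>i\<close>. A vector \<open>A\<^sub>i u\<close> with \<open>u \<in> K\<^sub>i\<close> lies
  in \<open>Lin (A K)\<close> iff \<open>- A\<^sub>i u = A x'\<close> for some \<open>x' \<in> K\<close>, and then \<open>x' + u\<close> is an element of the
  kernel of \<open>A\<close> in \<open>K\<close>; this yields \<open>B\<close> and \<open>N\<^sub>0\<close>. For \<open>N\<close> and \<open>B\<^sub>0\<close>, put \<open>C = closure (A K)\<close>, whose
  dual consists of the \<open>y\<close> with \<open>A\<^sup>T y \<in> K\<^sup>*\<close>. By the bipolar theorem \<open>Lin C\<close> is the annihilator of
  the dual of \<open>C\<close> inside \<open>C\<close>, and a single relative interior point \<open>y\<close> of that dual is positive on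
  all of \<open>C - Lin C\<close>, so it works for all indices of \<open>N\<close> simultaneously.
\<close>

section \<open>Dual cones and lineality spaces\<close>

lemma dual_cone_eq_INT: "dual_cone C = (\<Inter>x\<in>C. {s. 0 \<le> x \<bullet> s})"
  by (auto simp: dual_cone_def inner_commute)

lemma convex_cone_dual_cone: "convex_cone (dual_cone C)"
  unfolding dual_cone_eq_INT by (rule convex_cone_Inter) (auto simp: convex_cone_halfspace_ge)

lemma dual_cone_closure: "dual_cone (closure C) = dual_cone C"
proof
  show "dual_cone (closure C) \<subseteq> dual_cone C"
    using closure_subset[of C] by (auto simp: dual_cone_def)
  show "dual_cone C \<subseteq> dual_cone (closure C)"
  proof
    fix s assume "s \<in> dual_cone C"
    then have "C \<subseteq> {x. 0 \<le> s \<bullet> x}" by (auto simp: dual_cone_def)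
    then have "closure C \<subseteq> {x. 0 \<le> s \<bullet> x}"
      by (rule closure_minimal) (rule closed_halfspace_ge)
    then show "s \<in> dual_cone (closure C)" by (auto simp: dual_cone_def)
  qed
qed

text \<open>Multiplication by a fixed \<open>c\<close> is continuous, so it carries limits of points
  of \<open>C\<close> to limits of points of \<open>C\<close>.\<close>

lemma convex_cone_closure:
  fixes C :: "'a::real_normed_vector set"
  assumes "convex_cone C"
  shows "convex_cone (closure C)"
proof -
  have "c *\<^sub>R x \<in> closure C" if "x \<in> closure C" "0 \<le> c" for c x
  proof -
    have "(*\<^sub>R) c ` C \<subseteq> closure C"
      using convex_cone_scaleR[OF assms \<open>0 \<le> c\<close>] closure_subset by blast
    then have "(*\<^sub>R) c ` closure C \<subseteq> closure C"
      by (intro image_closure_subset) (auto intro: continuous_intros)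
    with that show ?thesis by blast
  qed
  then show ?thesis using assms by (auto simp: convex_cone_def conic_def)
qed

text \<open>A point outside \<open>C\<close> is strictly separated from \<open>C\<close> by some
  \<open>a\<close>; because \<open>C\<close> is a cone, \<open>a\<close> lies in the dual cone yet
  is negative at \<open>z\<close>.\<close>

lemma bipolar:
  fixes C :: "'a::euclidean_space set"
  assumes C: "convex_cone C" "closed C" and z: "\<And>y. y \<in> dual_cone C \<Longrightarrow> 0 \<le> y \<bullet> z"
  shows "z \<in> C"
proof (rule ccontr)
  assume "z \<notin> C"
  moreover have "convex C" using C by (simp add: convex_cone_def)
  ultimately obtain a \<beta> where a: "a \<bullet> z < \<beta>" "\<And>x. x \<in> C \<Longrightarrow> \<beta> < a \<bullet> x"
    using separating_hyperplane_closed_point C(2) by metis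
  have "\<beta> < 0" using a(2)[OF convex_cone_contains_0[OF C(1)]] by simp
  have "0 \<le> a \<bullet> x" if x: "x \<in> C" for x
  proof (rule ccontr)
    assume "\<not> 0 \<le> a \<bullet> x"
    then have neg: "a \<bullet> x < 0" by simp
    \<comment> \<open>The factor rescales \<open>x\<close> to a point of \<open>C\<close> where
      \<open>a\<close> takes exactly the value \<open>\<beta>\<close>, against the strict
      separation.\<close>
    have "(\<beta> / (a \<bullet> x)) *\<^sub>R x \<in> C"
      using C(1) x neg \<open>\<beta> < 0\<close> by (intro convex_cone_scaleR) (auto simp: divide_nonpos_nonpos)
    from a(2)[OF this] neg show False by simp
  qed
  then have "a \<in> dual_cone C" by (simp add: dual_cone_def)
  from z[OF this] a(1) \<open>\<beta> < 0\<close> show False by simp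
qed

text \<open>A dual vector is nonnegative at both \<open>z\<close> and \<open>- z\<close>, hence zero
  there; the converse applies \<open>bipolar\<close> to \<open>z\<close> and to
  \<open>- z\<close>.\<close>

lemma mem_Lin_iff_dual_orthogonal:
  fixes C :: "'a::euclidean_space set"
  assumes "convex_cone C" "closed C"
  shows "z \<in> Lin C \<longleftrightarrow> (\<forall>y\<in>dual_cone C. y \<bullet> z = 0)"
proof
  assume "z \<in> Lin C"
  then have "0 \<le> y \<bullet> z" "0 \<le> y \<bullet> (- z)" if "y \<in> dual_cone C" for y
    using that by (auto simp: Lin_def dual_cone_def simp del: inner_minus_right)
  then show "\<forall>y\<in>dual_cone C. y \<bullet> z = 0" by (force simp: order_eq_iff)
next
  assume *: "\<forall>y\<in>dual_cone C. y \<bullet> z = 0"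
  have "z \<in> C" "- z \<in> C" by (rule bipolar[OF assms]; simp add: *)+
  then show "z \<in> Lin C" by (simp add: Lin_def)
qed

text \<open>The segment from \<open>d\<close> to \<open>y\<close> can be prolonged inside
  \<open>D\<close> beyond \<open>y\<close>; were the functional positive at \<open>d\<close>, it
  would be negative on the prolongation.\<close>

lemma nonneg_on_eq_0_at_rel_interior:
  fixes D :: "'a::euclidean_space set"
  assumes D: "convex D" "y \<in> rel_interior D" and z: "\<And>d. d \<in> D \<Longrightarrow> 0 \<le> z \<bullet> d" "z \<bullet> y = 0"
    and d: "d \<in> D"
  shows "z \<bullet> d = 0"
proof -
  obtain e where e: "e > 1" "(1 - e) *\<^sub>R d + e *\<^sub>R y \<in> D"
    using convex_rel_interior_if2[OF D] d hull_inc by metis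
  have "0 \<le> (1 - e) * (z \<bullet> d)"
    using z(1)[OF e(2)] z(2) by (simp add: inner_right_distrib)
  with e(1) have "z \<bullet> d \<le> 0" by (simp add: zero_le_mult_iff)
  with z(1)[OF d] show ?thesis by simp
qed

text \<open>Adding \<open>e *\<^sub>R v\<close> to a prolongation of the segment from
  \<open>x\<close> to \<open>u\<close> gives one of the segment from \<open>x\<close> to
  \<open>v + u\<close>, and the cone absorbs the added vector.\<close>

lemma convex_cone_add_rel_interior:
  fixes K :: "'a::euclidean_space set"
  assumes K: "convex_cone K" and u: "u \<in> rel_interior K" and v: "v \<in> K"
  shows "v + u \<in> rel_interior K"
proof -
  have cK: "convex K" "K \<noteq> {}" using K by (auto simp: convex_cone_def)
  have "\<exists>e>1. (1 - e) *\<^sub>R x + e *\<^sub>R (v + u) \<in> K" if x: "x \<in> K" for x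
  proof -
    obtain e where e: "e > 1" "(1 - e) *\<^sub>R x + e *\<^sub>R u \<in> K"
      using convex_rel_interior_if2[OF cK(1) u] hull_inc[OF x, of affine] by auto
    then have "e *\<^sub>R v + ((1 - e) *\<^sub>R x + e *\<^sub>R u) \<in> K"
      using convex_cone_add[OF K convex_cone_scaleR[OF K _ v]] e by simp
    with e(1) show ?thesis by (auto simp: algebra_simps)
  qed
  then show ?thesis by (simp add: convex_rel_interior_iff[OF cK])
qed

text \<open>For \<open>z\<close> in \<open>C\<close> the functional given by \<open>z\<close> is
  nonnegative on the dual cone. If it vanished at \<open>y\<close> it would vanish on the whole dual
  cone, which would put \<open>z\<close> into \<open>Lin C\<close>.\<close>

lemma rel_interior_dual_cone_pos:
  fixes C :: "'a::euclidean_space set"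
  assumes C: "convex_cone C" "closed C" and y: "y \<in> rel_interior (dual_cone C)"
    and z: "z \<in> C" "z \<notin> Lin C"
  shows "0 < y \<bullet> z"
proof -
  have nn: "0 \<le> z \<bullet> d" if "d \<in> dual_cone C" for d
    using that z(1) by (simp add: dual_cone_def inner_commute[of z])
  have "y \<bullet> z \<noteq> 0"
  proof
    assume "y \<bullet> z = 0"
    then have "\<forall>d\<in>dual_cone C. d \<bullet> z = 0"
      using nonneg_on_eq_0_at_rel_interior[of "dual_cone C" y z] y nn convex_cone_dual_cone
      by (metis convex_cone_def inner_commute)
    with z(2) mem_Lin_iff_dual_orthogonal[OF C] show False by blast
  qed
  moreover have "0 \<le> y \<bullet> z"
    using nn[of y] y rel_interior_subset[of "dual_cone C"] by (auto simp: inner_commute)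
  ultimately show ?thesis by simp
qed

section \<open>Blocks\<close>

lemma subspace_block_space: "subspace (block_space b i)"
  by (auto simp: subspace_def block_space_def)

lemma linear_vec_block: "linear (vec_block b i)"
  by (intro linearI) (auto simp: vec_block_def vec_eq_iff)

lemma vec_block_in_block_space: "vec_block b i x \<in> block_space b i"
  by (simp add: vec_block_def block_space_def)

lemma vec_block_same: "x \<in> block_space b i \<Longrightarrow> vec_block b i x = x"
  by (auto simp: vec_block_def block_space_def vec_eq_iff)

lemma vec_block_other: "x \<in> block_space b i \<Longrightarrow> j \<noteq> i \<Longrightarrow> vec_block b j x = 0"
  by (auto simp: vec_block_def block_space_def vec_eq_iff)

lemma inner_vec_block: "vec_block b i s \<bullet> u = s \<bullet> vec_block b i u"
  by (auto simp: vec_block_def inner_vec_def intro!: sum.cong)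

lemma mat_block_mult: "mat_block b i A *v x = A *v vec_block b i x"
  by (auto simp: mat_block_def vec_block_def matrix_vector_mult_def vec_eq_iff intro!: sum.cong)

lemma transpose_mat_block_mult: "transpose (mat_block b i A) *v y = vec_block b i (transpose A *v y)"
  by (auto simp: mat_block_def vec_block_def matrix_vector_mult_def transpose_def vec_eq_iff)

lemma transpose_mult_inner: "(transpose A *v y) \<bullet> x = y \<bullet> (A *v x)" for A :: "real ^ 'n ^ 'm"
  by (simp add: dot_lmul_matrix)

section \<open>Interiors relative to a block space\<close>

lemma affine_hull_eq_block_space:
  assumes "S \<subseteq> block_space b i" "block_int b i S \<noteq> {}"
  shows "affine hull S = block_space b i"
proof -
  let ?V = "block_space b i"
  have V: "affine hull ?V = ?V"
    by (simp add: affine_hull_eq subspace_imp_affine subspace_block_space)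
  \<comment> \<open>A nonempty relatively open subset already has the full affine hull, and
    \<open>S\<close> lies between it and the block space.\<close>
  have "openin (top_of_set (affine hull ?V)) (block_int b i S)"
    unfolding V block_int_def by (rule openin_interior_of)
  then have "affine hull (block_int b i S) = ?V"
    using affine_hull_openin assms(2) V by metis
  moreover have "block_int b i S \<subseteq> S"
    unfolding block_int_def by (rule interior_of_subset)
  ultimately show ?thesis
    using assms(1) V by (metis hull_mono subset_antisym)
qed

text \<open>Makes the calculus of relative interiors, notably under linear images, available for
  block interiors.\<close>

lemma block_int_eq_rel_interior:
  assumes "S \<subseteq> block_space b i" "block_int b i S \<noteq> {}"
  shows "block_int b i S = rel_interior S"
  using interior_of_subset[of "top_of_set (block_space b i)" S]
  by (auto simp: block_int_def rel_interior_def interior_of_def affine_hull_eq_block_space[OF assms])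

lemma span_eq_block_space:
  assumes "S \<subseteq> block_space b i" "block_int b i S \<noteq> {}"
  shows "span S = block_space b i"
  using affine_hull_eq_block_space[OF assms] affine_hull_subset_span[of S]
    span_minimal[OF assms(1) subspace_block_space] by auto

lemma mem_block_int_iff_ball:
  "x \<in> block_int b i S \<longleftrightarrow> x \<in> block_space b i \<and> (\<exists>e>0. ball x e \<inter> block_space b i \<subseteq> S)"
proof
  assume "x \<in> block_int b i S"
  then obtain T where T: "open T" "x \<in> T" "x \<in> block_space b i" "block_space b i \<inter> T \<subseteq> S"
    by (auto simp: block_int_def interior_of_def openin_open)
  then obtain e where "e > 0" "ball x e \<subseteq> T" by (meson openE)
  with T show "x \<in> block_space b i \<and> (\<exists>e>0. ball x e \<inter> block_space b i \<subseteq> S)" by blast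
next
  assume "x \<in> block_space b i \<and> (\<exists>e>0. ball x e \<inter> block_space b i \<subseteq> S)"
  then obtain e where "x \<in> block_space b i" "e > 0" "ball x e \<inter> block_space b i \<subseteq> S" by blast
  then show "x \<in> block_int b i S"
    unfolding block_int_def interior_of_def openin_open
    by (intro CollectI exI[of _ "block_space b i \<inter> ball x e"]) auto
qed

text \<open>Moving an interior \<open>s\<close> slightly against \<open>u\<close> keeps it in the
  dual, which forces \<open>s \<bullet> u\<close> to be positive. Conversely, positivity is uniform
  on the compact set of unit vectors of \<open>K\<close> and thus survives small changes of
  \<open>s\<close>.\<close>

lemma mem_block_int_block_dual_iff:
  assumes K: "K \<subseteq> block_space b i" "closed K" "conic K"
  shows "s \<in> block_int b i (block_dual b i K) \<longleftrightarrow>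
    s \<in> block_space b i \<and> (\<forall>u\<in>K - {0}. 0 < s \<bullet> u)"
proof
  assume "s \<in> block_int b i (block_dual b i K)"
  then obtain e where s: "s \<in> block_space b i" and e: "e > 0"
      "ball s e \<inter> block_space b i \<subseteq> block_dual b i K"
    by (auto simp: mem_block_int_iff_ball)
  have "0 < s \<bullet> u" if u: "u \<in> K" "u \<noteq> 0" for u
  proof -
    \<comment> \<open>With this \<open>t\<close> the displacement \<open>t *\<^sub>R u\<close> has
      norm \<open>e / 2\<close>, inside the ball.\<close>
    define t where "t = e / (2 * norm u)"
    have t: "t > 0" using e u by (simp add: t_def)
    have "s - t *\<^sub>R u \<in> ball s e"
      using e u by (simp add: dist_norm t_def)
    moreover have "s - t *\<^sub>R u \<in> block_space b i"
      using s u K subspace_block_space by (metis subsetD subspace_diff subspace_scale)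
    ultimately have "0 \<le> (s - t *\<^sub>R u) \<bullet> u"
      using e(2) u(1) unfolding block_dual_def by blast
    then have "t * (u \<bullet> u) \<le> s \<bullet> u" by (simp add: inner_diff_left)
    moreover have "0 < t * (u \<bullet> u)" using t u by simp
    ultimately show ?thesis by linarith
  qed
  with s show "s \<in> block_space b i \<and> (\<forall>u\<in>K - {0}. 0 < s \<bullet> u)" by blast
next
  assume "s \<in> block_space b i \<and> (\<forall>u\<in>K - {0}. 0 < s \<bullet> u)"
  then have s: "s \<in> block_space b i" and pos: "\<And>u. u \<in> K \<Longrightarrow> u \<noteq> 0 \<Longrightarrow> 0 < s \<bullet> u" by auto
  let ?S = "K \<inter> sphere 0 1"
  obtain \<delta> where \<delta>: "\<delta> > 0" "\<And>u. u \<in> ?S \<Longrightarrow> \<delta> \<le> s \<bullet> u"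
  proof (cases "?S = {}")
    case True
    \<comment> \<open>Without unit vectors in \<open>K\<close> the bound is vacuous, so any positive
      constant serves.\<close>
    then show ?thesis using that[of 1] by auto
  next
    case False
    moreover have "compact ?S" using K(2) by (simp add: closed_Int_compact)
    moreover have "continuous_on ?S (\<lambda>u. s \<bullet> u)" by (intro continuous_intros)
    ultimately obtain v where v: "v \<in> ?S" "\<forall>u\<in>?S. s \<bullet> v \<le> s \<bullet> u"
      using continuous_attains_inf by blast
    moreover have "0 < s \<bullet> v" using v(1) pos[of v] by force
    ultimately show ?thesis using that by blast
  qed
  have "0 \<le> s' \<bullet> u" if s': "dist s s' < \<delta>" and u: "u \<in> K" for s' u
  proof (cases "u = 0")
    case False
    define v where "v = (1 / norm u) *\<^sub>R u"
    have "v \<in> ?S" using u False K(3) by (simp add: v_def conic_def)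
    then have "\<delta> \<le> s \<bullet> v" "norm v = 1" using \<delta> by auto
    moreover have "(s - s') \<bullet> v \<le> norm (s - s') * norm v" by (rule norm_cauchy_schwarz)
    ultimately have "0 \<le> s' \<bullet> v" using s' by (simp add: inner_diff_left dist_norm)
    then show ?thesis using False by (simp add: v_def zero_le_divide_iff)
  qed simp
  then have "ball s \<delta> \<inter> block_space b i \<subseteq> block_dual b i K"
    by (auto simp: block_dual_def)
  with s \<delta>(1) show "s \<in> block_int b i (block_dual b i K)"
    by (auto simp: mem_block_int_iff_ball)
qed

section \<open>Regular block cones and their product\<close>

lemma regular_block_coneD:
  assumes "regular_block_cone b i C"
  shows "C \<subseteq> block_space b i" "closed C" "convex_cone C" "block_int b i C = rel_interior C"
    "span C = block_space b i"
proof -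
  have C: "C \<subseteq> block_space b i" "block_int b i C \<noteq> {}" "closed C" "convex C" "cone C"
    using assms by (auto simp: regular_block_cone_def)
  \<comment> \<open>\<open>cone\<close> admits the empty set while \<open>convex_cone\<close> does
    not; the nonempty interior bridges the two.\<close>
  have "C \<noteq> {}" using C(2) by (auto simp: block_int_def interior_of_def)
  with C show "convex_cone C" by (auto simp: convex_cone_def conic_def cone_def)
  show "block_int b i C = rel_interior C" "span C = block_space b i"
    using C block_int_eq_rel_interior span_eq_block_space by blast+
qed (use assms in \<open>auto simp: regular_block_cone_def\<close>)

lemma regular_block_cone_pointed:
  assumes "regular_block_cone b i C" "u \<in> C" "- u \<in> C"
  shows "u = 0"
proof (rule ccontr)
  assume "u \<noteq> 0"
  have "t *\<^sub>R u \<in> C" for t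
  proof (cases "t \<ge> 0")
    case False
    then have "(- t) *\<^sub>R (- u) \<in> C"
      using assms(3) regular_block_coneD(3)[OF assms(1)] by (intro convex_cone_scaleR) auto
    then show ?thesis by simp
  qed (use assms regular_block_coneD(3) convex_cone_scaleR in blast)
  then have "contains_line C"
    unfolding contains_line_def using \<open>u \<noteq> 0\<close> by (intro exI[of _ 0] exI[of _ u]) simp
  with assms(1) show False by (simp add: regular_block_cone_def)
qed

lemma convex_cone_prod_cone:
  assumes "\<And>i. convex_cone (K i)"
  shows "convex_cone (prod_cone b K)"
proof -
  have "0 \<in> prod_cone b K"
    using assms by (simp add: prod_cone_def linear_0[OF linear_vec_block] convex_cone_contains_0)
  moreover have "x + y \<in> prod_cone b K" if "x \<in> prod_cone b K" "y \<in> prod_cone b K" for x y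
    using that assms by (simp add: prod_cone_def linear_add[OF linear_vec_block] convex_cone_add)
  moreover have "c *\<^sub>R x \<in> prod_cone b K" if "x \<in> prod_cone b K" "0 \<le> c" for c x
    using that assms by (simp add: prod_cone_def linear_scale[OF linear_vec_block] convex_cone_scaleR)
  ultimately show ?thesis by (auto simp: convex_cone_iff)
qed

text \<open>A vector padded with zeros has zero in all other blocks, and every factor contains
  0.\<close>

lemma block_subset_prod_cone:
  assumes "\<And>i. convex_cone (K i)" "K i \<subseteq> block_space b i"
  shows "K i \<subseteq> prod_cone b K"
proof
  fix u assume "u \<in> K i"
  moreover have "u \<in> block_space b i" using calculation assms(2) by blast
  ultimately have "vec_block b j u \<in> K j" for j
    using assms(1) by (cases "j = i") (auto simp: vec_block_same vec_block_other convex_cone_contains_0)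
  then show "u \<in> prod_cone b K" by (simp add: prod_cone_def)
qed

text \<open>Adjointness of \<open>A\<close> and its transpose; with \<open>dual_cone_closure\<close>
  it describes the dual of the closed image cone.\<close>

lemma dual_cone_image_iff:
  "y \<in> dual_cone ((*v) A ` S) \<longleftrightarrow> transpose A *v y \<in> dual_cone S" for A :: "real ^ 'n ^ 'm"
  by (auto simp: dual_cone_def transpose_mult_inner simp del: transpose_matrix_vector)

section \<open>The partitions\<close>

theorem theorem1:
  fixes b :: "'n::finite \<Rightarrow> 'r::finite"
    and K :: "'r \<Rightarrow> (real ^ 'n) set"
    and A :: "real ^ 'n ^ 'm::finite"
  assumes "\<And>i. regular_block_cone b i (K i)"
  shows
    "(index_B b K A =
        {i. rel_interior ((*v) (mat_block b i A) ` K i) \<inter> Lin ((*v) A ` prod_cone b K) \<noteq> {}} \<and>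
      index_N b K A =
        {i. (*v) (mat_block b i A) ` (K i - {0}) \<inter> Lin (closure ((*v) A ` prod_cone b K)) = {}}) \<and>
     (index_B0 b K A =
        {i. rel_interior ((*v) (mat_block b i A) ` K i) \<inter> Lin (closure ((*v) A ` prod_cone b K)) \<noteq> {}} \<and>
      index_N0 b K A =
        {i. (*v) (mat_block b i A) ` (K i - {0}) \<inter> Lin ((*v) A ` prod_cone b K) = {}})"
proof -

  \<comment> \<open>Facts shared by the four identities\<close>
  define P where "P = prod_cone b K"
  define C where "C = closure ((*v) A ` P)"
  note reg = regular_block_coneD[OF assms]
  have P: "convex_cone P"
    unfolding P_def by (rule convex_cone_prod_cone) (rule reg)
  have KP: "u \<in> P" if "u \<in> K i" for u i
    using that block_subset_prod_cone[of K i b] reg(1,3) by (auto simp: P_def)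
  have blk: "vec_block b i u = u" if "u \<in> K i" for u i
    using that reg(1) by (blast intro: vec_block_same)
  have PK: "vec_block b i x \<in> K i" if "x \<in> P" for x i
    using that by (simp add: P_def prod_cone_def)
  have Au: "mat_block b i A *v u = A *v u" if "u \<in> K i" for u i
    using that by (simp add: mat_block_mult blk)
  have C: "convex_cone C" "closed C"
    unfolding C_def
    by (auto intro!: convex_cone_closure convex_cone_linear_image P matrix_vector_mul_linear)
  have AC: "A *v u \<in> C" if "u \<in> P" for u
    unfolding C_def by (rule subsetD[OF closure_subset imageI[OF that]])
  have dual: "y \<in> dual_cone C \<longleftrightarrow> transpose A *v y \<in> dual_cone P" for y
    unfolding C_def dual_cone_closure by (rule dual_cone_image_iff)
  \<comment> \<open>Relative interiors of convex sets commute with linear images, and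
    \<open>A\<close> agrees with its block on \<open>K i\<close>.\<close>
  have ri: "rel_interior ((*v) (mat_block b i A) ` K i) = (*v) A ` rel_interior (K i)" for i
  proof -
    have "rel_interior ((*v) (mat_block b i A) ` K i) = (*v) (mat_block b i A) ` rel_interior (K i)"
      using rel_interior_convex_linear_image[OF matrix_vector_mul_linear] reg(3)[of i]
      by (metis convex_cone_def)
    also have "\<dots> = (*v) A ` rel_interior (K i)"
      by (rule image_cong) (use rel_interior_subset Au in auto)
    finally show ?thesis .
  qed
  have im: "(*v) (mat_block b i A) ` (K i - {0}) = (*v) A ` (K i - {0})" for i
    using Au by (intro image_cong) auto
  \<comment> \<open>For the block \<open>u\<close> of a kernel vector \<open>x\<close>,
    \<open>- (A *v u)\<close> is the image of \<open>x - u\<close>, which stays in \<open>P\<close>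
    because only block \<open>i\<close> is replaced by 0.\<close>
  have LinI: "A *v vec_block b i x \<in> Lin ((*v) A ` P)" if x: "x \<in> P" "A *v x = 0" for x i
  proof -
    let ?u = "vec_block b i x"
    have "vec_block b j (x - ?u) \<in> K j" for j
      using PK[OF x(1)] convex_cone_contains_0[OF reg(3)]
      by (cases "j = i") (auto simp: linear_diff[OF linear_vec_block]
          vec_block_same[OF vec_block_in_block_space] vec_block_other[OF vec_block_in_block_space])
    then have "x - ?u \<in> P" by (simp add: P_def prod_cone_def)
    moreover have "- (A *v ?u) = A *v (x - ?u)"
      using x by (simp add: matrix_vector_mult_diff_distrib)
    ultimately show ?thesis using KP PK[OF x(1)] by (auto simp: Lin_def)
  qed
  have LinE: "\<exists>x'\<in>P. A *v (x' + u) = 0 \<and> x' + u \<in> P \<and>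
      vec_block b i (x' + u) = vec_block b i x' + u"
    if u: "u \<in> K i" "A *v u \<in> Lin ((*v) A ` P)" for u i
  proof -
    obtain x' where x': "x' \<in> P" "- (A *v u) = A *v x'"
      using u(2) by (auto simp: Lin_def)
    have "A *v (x' + u) = 0"
      using x'(2) by (metis add.left_inverse matrix_vector_right_distrib)
    then show ?thesis
      using x'(1) u KP convex_cone_add[OF P] by (auto simp: linear_add[OF linear_vec_block] blk)
  qed
  have perp: "vec_block b i (transpose A *v y) \<bullet> u = y \<bullet> (A *v u)" if "u \<in> K i" for y u i
    using that by (simp add: inner_vec_block blk transpose_mult_inner del: transpose_matrix_vector)

  \<comment> \<open>Kernel conditions: \<open>B\<close> and \<open>N0\<close>\<close>
  have B: "i \<in> index_B b K A \<longleftrightarrow> (*v) A ` rel_interior (K i) \<inter> Lin ((*v) A ` P) \<noteq> {}" for i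
  proof
    assume "i \<in> index_B b K A"
    then obtain x where "A *v x = 0" "x \<in> P" "vec_block b i x \<in> rel_interior (K i)"
      by (auto simp: index_B_def P_def reg(4))
    with LinI[of x i] show "(*v) A ` rel_interior (K i) \<inter> Lin ((*v) A ` P) \<noteq> {}" by blast
  next
    assume "(*v) A ` rel_interior (K i) \<inter> Lin ((*v) A ` P) \<noteq> {}"
    then obtain u where u: "u \<in> rel_interior (K i)" "A *v u \<in> Lin ((*v) A ` P)" by blast
    then obtain x' where x': "x' \<in> P" "A *v (x' + u) = 0" "x' + u \<in> P"
        "vec_block b i (x' + u) = vec_block b i x' + u"
      using LinE[of u i] rel_interior_subset by blast
    \<comment> \<open>The correction \<open>x'\<close> may alter block \<open>i\<close>, but only by
      an element of \<open>K i\<close>, which preserves relative interiority.\<close>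
    have "vec_block b i x' + u \<in> rel_interior (K i)"
      using reg(3) u(1) PK[OF x'(1)] by (rule convex_cone_add_rel_interior)
    with x' show "i \<in> index_B b K A"
      unfolding index_B_def reg(4) P_def by auto
  qed
  have N0: "i \<in> index_N0 b K A \<longleftrightarrow> (*v) A ` (K i - {0}) \<inter> Lin ((*v) A ` P) = {}" for i
  proof
    assume i: "i \<in> index_N0 b K A"
    have "u = 0" if u: "u \<in> K i" "A *v u \<in> Lin ((*v) A ` P)" for u
    proof -
      obtain x' where "x' \<in> P" "vec_block b i x' + u = 0"
        using LinE[OF u] i by (auto simp: index_N0_def P_def)
      \<comment> \<open>Here \<open>- u\<close> is the block of \<open>x'\<close>, so pointedness of
        \<open>K i\<close> applies.\<close>
      then have "- u \<in> K i" using PK[of x' i] by (simp add: eq_neg_iff_add_eq_0 [symmetric])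
      then show ?thesis using regular_block_cone_pointed assms u(1) by blast
    qed
    then show "(*v) A ` (K i - {0}) \<inter> Lin ((*v) A ` P) = {}" by blast
  next
    assume "(*v) A ` (K i - {0}) \<inter> Lin ((*v) A ` P) = {}"
    with LinI PK show "i \<in> index_N0 b K A"
      unfolding index_N0_def P_def[symmetric] by blast
  qed

  \<comment> \<open>Dual conditions: \<open>N\<close> and \<open>B0\<close>\<close>
  have N: "i \<in> index_N b K A \<longleftrightarrow> (*v) A ` (K i - {0}) \<inter> Lin C = {}" for i
  proof -
    have int: "s \<in> block_int b i (block_dual b i (K i)) \<longleftrightarrow>
        s \<in> block_space b i \<and> (\<forall>u\<in>K i - {0}. 0 < s \<bullet> u)" for s
      using reg(1-3) by (intro mem_block_int_block_dual_iff) (auto simp: convex_cone_def)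
    have "i \<in> index_N b K A \<longleftrightarrow> (\<exists>y\<in>dual_cone C. \<forall>u\<in>K i - {0}. 0 < y \<bullet> (A *v u))"
      unfolding index_N_def P_def[symmetric] dual[symmetric] transpose_mat_block_mult
      by (auto simp: int perp vec_block_in_block_space simp del: transpose_matrix_vector)
    also have "\<dots> \<longleftrightarrow> (*v) A ` (K i - {0}) \<inter> Lin C = {}"
    proof
      assume "\<exists>y\<in>dual_cone C. \<forall>u\<in>K i - {0}. 0 < y \<bullet> (A *v u)"
      then obtain y where y: "y \<in> dual_cone C" "\<And>u. u \<in> K i - {0} \<Longrightarrow> 0 < y \<bullet> (A *v u)"
        by blast
      have "A *v u \<notin> Lin C" if "u \<in> K i - {0}" for u
        using y(1) y(2)[OF that] mem_Lin_iff_dual_orthogonal[OF C] by force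
      then show "(*v) A ` (K i - {0}) \<inter> Lin C = {}" by blast
    next
      assume disj: "(*v) A ` (K i - {0}) \<inter> Lin C = {}"
      have "convex (dual_cone C)" "dual_cone C \<noteq> {}"
        using convex_cone_dual_cone[of C] by (auto simp: convex_cone_def)
      then obtain y where y: "y \<in> rel_interior (dual_cone C)"
        using rel_interior_eq_empty by blast
      \<comment> \<open>Each \<open>A *v u\<close> lies in \<open>C\<close> and, by disjointness,
        outside \<open>Lin C\<close>.\<close>
      have "0 < y \<bullet> (A *v u)" if "u \<in> K i - {0}" for u
        using that disj KP AC by (intro rel_interior_dual_cone_pos[OF C y]) auto
      with y show "\<exists>y\<in>dual_cone C. \<forall>u\<in>K i - {0}. 0 < y \<bullet> (A *v u)"
        using rel_interior_subset by blast
    qed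
    finally show ?thesis .
  qed
  have B0: "i \<in> index_B0 b K A \<longleftrightarrow> (*v) A ` rel_interior (K i) \<inter> Lin C \<noteq> {}" for i
  proof -
    have zero: "vec_block b i (transpose A *v y) = 0 \<longleftrightarrow> (\<forall>u\<in>K i. y \<bullet> (A *v u) = 0)" for y
    proof
      assume *: "\<forall>u\<in>K i. y \<bullet> (A *v u) = 0"
      define s where "s = vec_block b i (transpose A *v y)"
      have "orthogonal s u" if "u \<in> K i" for u
        unfolding s_def orthogonal_def perp[OF that] using * that by blast
      \<comment> \<open>\<open>K i\<close> spans its block space, so a block vector orthogonal to
        \<open>K i\<close> is orthogonal to itself.\<close>
      moreover have "s \<in> span (K i)"
        unfolding reg(5) s_def by (rule vec_block_in_block_space)
      ultimately have "orthogonal s s" by (rule orthogonal_to_span[rotated])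
      then show "vec_block b i (transpose A *v y) = 0"
        unfolding s_def[symmetric] by (simp only: orthogonal_self)
    next
      assume "vec_block b i (transpose A *v y) = 0"
      then show "\<forall>u\<in>K i. y \<bullet> (A *v u) = 0"
        using perp[of _ i y] by (metis inner_zero_left)
    qed
    have "i \<in> index_B0 b K A \<longleftrightarrow> (\<forall>y\<in>dual_cone C. \<forall>u\<in>K i. y \<bullet> (A *v u) = 0)"
      unfolding index_B0_def P_def[symmetric] dual[symmetric] transpose_mat_block_mult
      by (simp add: zero Ball_def del: transpose_matrix_vector)
    also have "\<dots> \<longleftrightarrow> (*v) A ` rel_interior (K i) \<inter> Lin C \<noteq> {}"
    proof
      assume *: "\<forall>y\<in>dual_cone C. \<forall>u\<in>K i. y \<bullet> (A *v u) = 0"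
      obtain u where u: "u \<in> rel_interior (K i)"
        using reg(3)[of i] rel_interior_eq_empty[of "K i"] by (auto simp: convex_cone_def)
      then have "A *v u \<in> Lin C"
        using * rel_interior_subset by (subst mem_Lin_iff_dual_orthogonal[OF C]) blast
      with u show "(*v) A ` rel_interior (K i) \<inter> Lin C \<noteq> {}" by blast
    next
      assume "(*v) A ` rel_interior (K i) \<inter> Lin C \<noteq> {}"
      then obtain p where p: "p \<in> rel_interior (K i)" "A *v p \<in> Lin C" by blast
      show "\<forall>y\<in>dual_cone C. \<forall>u\<in>K i. y \<bullet> (A *v u) = 0"
      proof (intro ballI)
        fix y u assume y: "y \<in> dual_cone C" and u: "u \<in> K i"
        \<comment> \<open>The functional \<open>transpose A *v y\<close> is nonnegative on
          \<open>K i\<close> and vanishes at the relative interior point \<open>p\<close>, hence on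
          all of \<open>K i\<close>.\<close>
        have nn: "0 \<le> (transpose A *v y) \<bullet> v" if "v \<in> K i" for v
          using y that KP dual by (auto simp: dual_cone_def)
        have "(transpose A *v y) \<bullet> p = 0"
          using y p(2) mem_Lin_iff_dual_orthogonal[OF C]
          by (auto simp: transpose_mult_inner simp del: transpose_matrix_vector)
        moreover have "convex (K i)" using reg(3)[of i] by (simp add: convex_cone_def)
        ultimately have "(transpose A *v y) \<bullet> u = 0"
          using nonneg_on_eq_0_at_rel_interior[OF _ p(1) nn _ u] by blast
        then show "y \<bullet> (A *v u) = 0"
          by (simp add: transpose_mult_inner del: transpose_matrix_vector)
      qed
    qed
    finally show ?thesis .
  qed
  show ?thesis
    unfolding ri im P_def[symmetric] C_def[symmetric]
    by (intro conjI set_eqI; simp only: mem_Collect_eq B N B0 N0)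
qed

end
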